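(* Let $\mathcal{C}\subseteq\mathbb{F}_2^N$ be any linear block code (transmitted codeword $\underline{W}$ uniform on $\mathcal{C}$, each coordinate $W_i$ uniform on $\mathbb{F}_2$) and consider any output-symmetric channel whose reliabilities $|\ell_i|$ have a continuous (atomless) distribution. Consider ORB-type GRAND decoding with $\pi$ the rank-based permutation. Fix a set of $T$ distinct candidate error patterns in $\mathbb{F}_2^N$ and consider all its orderings $\underline{e}(1),\dots,\underline{e}(T)$. Then among the orderings that maximize the decoding success probability, at least one has an associated sequence $\{p_t\}_{t=1}^T$ that is non-increasing, i.e. $p_1\ge p_2\ge\cdots\ge p_T$, where $p_t=\mathbf{E}_{\underline{Y}}\left[P_{\underline{W}|\underline{Y}}(\theta(\underline{Y})\oplus\pi_{\underline{Y}}(\underline{e}(t))\mid\underline{Y})\right]$.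
   Context: Channel: $q_0,q_1$ are probability densities on $\mathbb{R}$; when $\underline{w}\in\mathbb{F}_2^N$ is sent, the output $\underline{Y}\in\mathbb{R}^N$ has density $\prod_i q_{w_i}(y_i)$. The log-likelihood ratios are $\ell_i=\log(q_0(y_i)/q_1(y_i))$ and the hard decision is $\theta(\underline{y})\in\mathbb{F}_2^N$ with $\theta(\underline y)_i=\mathbf{1}(\ell_i<0)$. The channel is output-symmetric if $q_0(y)=q_1(-y)$ for all $y\in\mathbb{R}$. Rank-based permutation: let $r_i$ be the position of $|\ell_i|$ in the ascending ordering of $|\ell_1|,\dots,|\ell_N|$; then $\pi_{\underline{y}}$ acts on $\underline{e}\in\mathbb{F}_2^N$ by $\pi_{\underline{y}}(\underline{e})_i=e_{r_i}$. ORB-type GRAND decoding with ordered list $\underline{e}(1),\dots,\underline{e}(T)$: given $\underline{y}$, the decoder tests for $t=1,2,\dots,T$ whether $\theta(\underline{y})\oplus\pi_{\underline{y}}(\underline{e}(t))\in\mathcal{C}$; it stops at the first $t$ for which this holds and outputs that codeword; if no $t\le T$ works, it declares failure. The decoding success probability is the probability that the output equals the transmitted codeword. A linear block code here is a $K$-dimensional linear subspace $\mathcal{C}$ of $\mathbb{F}_2^N$ (with $2^K$ codewords). *)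

theory Defs
  imports
    "HOL-Probability.Probability"
    "HOL-Library.Z2"
    "HOL-Combinatorics.Multiset_Permutations"
begin

text \<open>
  Length-\<open>N\<close> vectors are indexed by an arbitrary finite linearly ordered type \<open>'n\<close>, standing for
  \<open>1 < \<dots> < N\<close> with \<open>N = CARD('n)\<close>; the order is what makes ``position in an ordering'' an index
  again.  The field \<open>F\<^sub>2\<close> is \<open>bit\<close>, and addition on \<open>bit ^ 'n\<close> is coordinatewise XOR.
  A channel is given by \<open>q :: bit \<Rightarrow> real \<Rightarrow> real\<close>, with \<open>q b\<close> the output density for input \<open>b\<close>.
\<close>

instance bit :: finite
proof
  have "(UNIV :: bit set) = {0, 1}" by auto
  then show "finite (UNIV :: bit set)" by (metis finite.emptyI finite.insertI)
qed

definition prob_density :: "(real \<Rightarrow> real) \<Rightarrow> bool" where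
  "prob_density f \<longleftrightarrow>
     f \<in> borel_measurable borel \<and> (\<forall>y. 0 \<le> f y) \<and> (\<integral>\<^sup>+ y. ennreal (f y) \<partial>lborel) = 1"

definition output_symmetric :: "(bit \<Rightarrow> real \<Rightarrow> real) \<Rightarrow> bool" where
  "output_symmetric q \<longleftrightarrow> (\<forall>y. q 0 y = q 1 (- y))"

definition linear_block_code :: "nat \<Rightarrow> (bit ^ 'n) set \<Rightarrow> bool" where
  "linear_block_code K C \<longleftrightarrow> vec.subspace C \<and> vec.dim C = K"

definition channel_density :: "(bit \<Rightarrow> real \<Rightarrow> real) \<Rightarrow> bit ^ 'n \<Rightarrow> real ^ 'n \<Rightarrow> real" where
  "channel_density q w y = (\<Prod>i\<in>UNIV. q (w $ i) (y $ i))"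

definition joint_law ::
    "(bit \<Rightarrow> real \<Rightarrow> real) \<Rightarrow> (bit ^ 'n) set \<Rightarrow>
     ((bit ^ 'n) \<times> (real ^ 'n)) measure" where
  "joint_law q C =
     density (measure_pmf (pmf_of_set C) \<Otimes>\<^sub>M lborel) (\<lambda>(w, y). ennreal (channel_density q w y))"

definition output_law :: "(bit \<Rightarrow> real \<Rightarrow> real) \<Rightarrow> (bit ^ 'n) set \<Rightarrow> (real ^ 'n) measure" where
  "output_law q C = distr (joint_law q C) borel snd"

text \<open>
  Bayes' rule for the conditional law of the codeword given the output; where the denominator (the
  density of the output) vanishes, which has probability zero, the value is \<open>0\<close>.
\<close>

definition posterior ::
    "(bit \<Rightarrow> real \<Rightarrow> real) \<Rightarrow> (bit ^ 'n) set \<Rightarrow>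
     real ^ 'n \<Rightarrow> bit ^ 'n \<Rightarrow> real" where
  "posterior q C y w =
     pmf (pmf_of_set C) w * channel_density q w y /
     (\<Sum>v\<in>C. pmf (pmf_of_set C) v * channel_density q v y)"

text \<open>
  The log-likelihood ratio is extended-real valued, with \<open>log (a / 0) = \<infinity>\<close> and \<open>log 0 = -\<infinity>\<close>.
  The value \<open>0\<close> where both densities vanish is arbitrary (an event of probability zero).
\<close>

definition llr :: "(bit \<Rightarrow> real \<Rightarrow> real) \<Rightarrow> real \<Rightarrow> ereal" where
  "llr q y =
     (if q 0 y = 0 \<and> q 1 y = 0 then 0
      else if q 1 y = 0 then \<infinity>
      else if q 0 y = 0 then - \<infinity>
      else ereal (ln (q 0 y / q 1 y)))"

definition reliability :: "(bit \<Rightarrow> real \<Rightarrow> real) \<Rightarrow> real ^ 'n \<Rightarrow> 'n \<Rightarrow> ereal" where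
  "reliability q y i = \<bar>llr q (y $ i)\<bar>"

definition atomless_reliabilities :: "(bit \<Rightarrow> real \<Rightarrow> real) \<Rightarrow> (bit ^ 'n) set \<Rightarrow> bool" where
  "atomless_reliabilities q C \<longleftrightarrow>
     (\<forall>i x. emeasure (distr (output_law q C) borel (\<lambda>y. reliability q y i)) {x} = 0)"

definition hard_decision :: "(bit \<Rightarrow> real \<Rightarrow> real) \<Rightarrow> real ^ 'n \<Rightarrow> bit ^ 'n" where
  "hard_decision q y = (\<chi> i. if llr q (y $ i) < 0 then 1 else 0)"

text \<open>
  \<open>rank_position q y i\<close> is the index \<open>r\<close> such that as many indices lie below \<open>r\<close> as there are
  \<open>j\<close> preceding \<open>i\<close> in the ascending ordering of the reliabilities.  Ties, which have probability
  zero under atomless reliabilities, are broken by index so that the map is always a permutation.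
\<close>

definition rank_position ::
    "(bit \<Rightarrow> real \<Rightarrow> real) \<Rightarrow> real ^ 'n::{finite, linorder} \<Rightarrow>
     'n \<Rightarrow> 'n" where
  "rank_position q y i =
     (THE r. card {j. j < r} =
        card {j. reliability q y j < reliability q y i \<or>
                 (reliability q y j = reliability q y i \<and> j < i)})"

definition rank_permute ::
    "(bit \<Rightarrow> real \<Rightarrow> real) \<Rightarrow> real ^ 'n::{finite, linorder} \<Rightarrow>
     bit ^ 'n::{finite, linorder} \<Rightarrow> bit ^ 'n::{finite, linorder}" where
  "rank_permute q y e = (\<chi> i. e $ rank_position q y i)"

definition candidate ::
    "(bit \<Rightarrow> real \<Rightarrow> real) \<Rightarrow> real ^ 'n::{finite, linorder} \<Rightarrow>
     bit ^ 'n::{finite, linorder} \<Rightarrow> bit ^ 'n::{finite, linorder}" where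
  "candidate q y e = hard_decision q y + rank_permute q y e"

text \<open>\<open>None\<close> is a declared decoding failure.\<close>

definition orb_decode ::
    "(bit \<Rightarrow> real \<Rightarrow> real) \<Rightarrow> (bit ^ 'n::{finite, linorder}) set \<Rightarrow>
     (bit ^ 'n::{finite, linorder}) list \<Rightarrow>
     real ^ 'n::{finite, linorder} \<Rightarrow> (bit ^ 'n::{finite, linorder}) option" where
  "orb_decode q C es y = find (\<lambda>c. c \<in> C) (map (candidate q y) es)"

definition success_prob ::
    "(bit \<Rightarrow> real \<Rightarrow> real) \<Rightarrow> (bit ^ 'n::{finite, linorder}) set \<Rightarrow>
     (bit ^ 'n::{finite, linorder}) list \<Rightarrow> real" where
  "success_prob q C es =
     measure (joint_law q C) {(w, y) \<in> space (joint_law q C). orb_decode q C es y = Some w}"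

text \<open>Positions in the list are counted from \<open>0\<close>.\<close>

definition p_seq ::
    "(bit \<Rightarrow> real \<Rightarrow> real) \<Rightarrow> (bit ^ 'n::{finite, linorder}) set \<Rightarrow>
     (bit ^ 'n::{finite, linorder}) list \<Rightarrow> nat \<Rightarrow> real"
  where
  "p_seq q C es t = (\<integral>y. posterior q C y (candidate q y (es ! t)) \<partial>output_law q C)"

end

theory Submission
  imports Defs
begin

text \<open>
  By output symmetry and linearity one may assume that the zero word was sent; then the decoder
  succeeds iff some pattern \<open>e\<close> of the list is the true noise pattern and no earlier pattern lies in
  the coset of \<open>e\<close> modulo the code carried back by the rank permutation.  The outputs are then
  exchangeable, so the rank permutation is uniform and independent of the noise pattern, and up to a
  constant factor the success probability is the sum, over all permutations \<open>\<tau>\<close>, of the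
  probabilities of those patterns that come first in their \<open>\<tau>\<close>-coset.  Sorting the list by
  decreasing probability puts a most likely pattern first in every coset, for all \<open>\<tau>\<close> at once.
\<close>

section \<open>Orderings of the candidate list\<close>

lemma find_map: "find P (map f xs) = map_option f (find (P \<circ> f) xs)"
  by (induction xs) auto

lemma find_SomeD:
  assumes "find P xs = Some x"
  shows "x \<in> set xs" "P x"
  using assms by (induction xs) (auto split: if_splits)

text \<open>In a list with decreasing weights the first hit is either \<open>y\<close> itself or
  stands before it.\<close>

lemma find_max_if_sorted:
  fixes p :: "'a \<Rightarrow> real"
  assumes "sorted_wrt (\<lambda>x y. p x \<ge> p y) xs" "find P xs = Some x" "y \<in> set xs" "P y"
  shows "p y \<le> p x"
  using assms by (induction xs) (auto split: if_splits)

text \<open>Phrased with \<open>find\<close> to match the decoder, whose search likewise stops at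
  the first hit. In particular a leader is a member of the list.\<close>

definition class_leader :: "('a \<Rightarrow> 'a \<Rightarrow> bool) \<Rightarrow> 'a list \<Rightarrow> 'a \<Rightarrow> bool" where
  "class_leader R xs e \<longleftrightarrow> find (\<lambda>x. R x e) xs = Some e"

text \<open>Each class that is met has one leader in either list. Sending a leader of
  \<open>ys\<close> to the leader of its class in \<open>xs\<close> is injective, and it never
  lowers \<open>p\<close>, because the sorted list puts a heaviest member of each class
  first.\<close>

lemma sum_class_leaders_le_sorted:
  fixes p :: "'a \<Rightarrow> real"
  assumes R: "equivp R" and p: "\<And>x. 0 \<le> p x" and sorted: "sorted_wrt (\<lambda>x y. p x \<ge> p y) xs"
    and set_eq: "set ys = set xs"
  shows "(\<Sum>e\<in>{e\<in>set ys. class_leader R ys e}. p e) \<le> (\<Sum>e\<in>{e\<in>set xs. class_leader R xs e}. p e)"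
proof -
  define A where "A zs = {e\<in>set zs. class_leader R zs e}" for zs
  define g where "g e = the (find (\<lambda>x. R x e) xs)" for e
  have g: "find (\<lambda>x. R x e) xs = Some (g e)" if "e \<in> set xs" for e
    unfolding g_def using that equivp_reflp[OF R, of e]
    by (cases "find (\<lambda>x. R x e) xs") (auto simp: find_None_iff)
  have R_eq: "find (\<lambda>x. R x a) zs = find (\<lambda>x. R x b) zs" if "R a b" for a b zs
    using equivp_transp[OF R] equivp_symp[OF R] that by (intro find_cong) blast+
  have A_D: "e \<in> set xs" "find (\<lambda>x. R x e) ys = Some e" if "e \<in> A ys" for e
    using that set_eq by (auto simp: A_def class_leader_def)
  have inj: "inj_on g (A ys)"
  proof (rule inj_onI)
    fix a b assume a: "a \<in> A ys" and b: "b \<in> A ys" and eq: "g a = g b"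
    have "R (g a) a" "R (g b) b"
      using find_SomeD(2)[OF g[OF A_D(1)[OF a]]] find_SomeD(2)[OF g[OF A_D(1)[OF b]]] by simp_all
    then have "R a b"
      using eq equivp_transp[OF R] equivp_symp[OF R] by metis
    then show "a = b"
      using R_eq[of a b ys] A_D(2)[OF a] A_D(2)[OF b] by simp
  qed
  have im: "g ` A ys \<subseteq> A xs"
  proof
    fix z assume "z \<in> g ` A ys"
    then obtain e where e: "e \<in> A ys" "z = g e" by auto
    have f: "find (\<lambda>x. R x e) xs = Some z"
      using g A_D(1) e by simp
    then show "z \<in> A xs"
      using find_SomeD[OF f] R_eq[of z e xs] f by (simp add: A_def class_leader_def)
  qed
  \<comment> \<open>Reflexivity makes \<open>e\<close> a hit of the very search that returns
    \<open>g e\<close>.\<close>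
  have "sum p (A ys) \<le> (\<Sum>e\<in>A ys. p (g e))"
    using find_max_if_sorted[OF sorted g] A_D(1) equivp_reflp[OF R]
    by (intro sum_mono) blast
  also have "\<dots> = sum p (g ` A ys)"
    using inj by (simp add: sum.reindex)
  also have "\<dots> \<le> sum p (A xs)"
    using im p by (intro sum_mono2) (auto simp: A_def)
  finally show ?thesis by (simp add: A_def)
qed

section \<open>Ranks\<close>

text \<open>If \<open>R x y\<close>, the predecessors of \<open>x\<close> form a proper subset of
  those of \<open>y\<close>, since \<open>x\<close> is only in the latter. So the counts increase
  strictly along the order.\<close>

lemma card_predecessors_inj:
  fixes R :: "'a::finite \<Rightarrow> 'a \<Rightarrow> bool"
  assumes irrefl: "\<And>x. \<not> R x x" and trans: "\<And>x y z. R x y \<Longrightarrow> R y z \<Longrightarrow> R x z"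
    and total: "\<And>x y. x \<noteq> y \<Longrightarrow> R x y \<or> R y x"
  shows "inj (\<lambda>x. card {y. R y x})"
proof -
  have less: "card {z. R z x} < card {z. R z y}" if "R x y" for x y
    using that irrefl trans by (intro psubset_card_mono) (auto simp: psubset_eq, blast)
  show ?thesis
    using less total by (metis (no_types, lifting) injI less_irrefl)
qed

lemma card_predecessors_less:
  fixes R :: "'a::finite \<Rightarrow> 'a \<Rightarrow> bool"
  assumes "\<And>x. \<not> R x x"
  shows "card {y. R y x} < CARD('a)"
  using assms by (intro psubset_card_mono) auto

text \<open>The tie-break by index makes the comparison a strict total order, so the count
  \<open>c\<close> is injective. The count \<open>k\<close> is injective into a set of equal size,
  hence onto, which makes the \<open>THE\<close> well defined. The rank is \<open>c\<close> followed
  by the inverse of \<open>k\<close>.\<close>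

lemma bij_rank_position:
  fixes y :: "real ^ 'n::{finite, linorder}"
  shows "bij (rank_position q y)"
proof -
  define c where
    "c i = card {j. reliability q y j < reliability q y i \<or>
      (reliability q y j = reliability q y i \<and> j < i)}" for i
  define k where "k r = card {j::'n. j < r}" for r
  have inj_c: "inj c" unfolding c_def by (rule card_predecessors_inj) auto
  have inj_k: "inj k" unfolding k_def by (rule card_predecessors_inj) auto
  have "range k = {..<CARD('n)}"
  proof (rule card_subset_eq)
    show "range k \<subseteq> {..<CARD('n)}"
      by (auto simp: k_def intro!: card_predecessors_less)
    show "card (range k) = card {..<CARD('n)}"
      using card_image[OF inj_k] by simp
  qed simp
  moreover have "c i < CARD('n)" for i
    unfolding c_def by (rule card_predecessors_less) auto
  ultimately have "\<exists>!r. k r = c i" for i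
    using inj_k by (metis (no_types, lifting) imageE injD lessThan_iff)
  then have "k (THE r. k r = c i) = c i" for i
    by (rule theI')
  then have "k (rank_position q y i) = c i" for i
    by (simp add: rank_position_def k_def c_def)
  then have "inj (rank_position q y)"
    using inj_c by (metis (no_types, lifting) injD injI)
  then show ?thesis
    by (simp add: bij_def finite_UNIV_inj_surj)
qed

section \<open>Symmetries of Lebesgue measure\<close>

lemma borel_measurable_vec_nth [measurable]: "(\<lambda>y :: real ^ 'n. y $ i) \<in> borel_measurable borel"
  by (intro borel_measurable_continuous_onI continuous_intros)

text \<open>This is Tonelli for products, moved from the index set \<open>Basis\<close> to
  coordinates by identifying \<open>i\<close> with its unit vector.\<close>

lemma nn_integral_lborel_vec_prod:
  fixes f :: "'n::finite \<Rightarrow> real \<Rightarrow> ennreal"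
  assumes [measurable]: "\<And>i. f i \<in> borel_measurable borel"
  shows "(\<integral>\<^sup>+y. (\<Prod>i\<in>UNIV. f i (y $ i)) \<partial>lborel) = (\<Prod>i\<in>UNIV. \<integral>\<^sup>+x. f i x \<partial>lborel)"
proof -
  define a where "a = (\<lambda>i::'n. axis i (1::real))"
  have inj: "inj a" by (auto simp: a_def inj_def axis_eq_axis)
  have B: "Basis = range a" by (auto simp: a_def Basis_vec_def)
  have "(\<integral>\<^sup>+y. (\<Prod>b\<in>Basis. f (inv a b) (y \<bullet> b)) \<partial>lborel) = (\<Prod>b\<in>Basis. \<integral>\<^sup>+x. f (inv a b) x \<partial>lborel)"
    by (rule nn_integral_lborel_prod) auto
  moreover have "y \<bullet> a i = y $ i" for y i
    by (simp add: a_def inner_axis)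
  ultimately show ?thesis
    unfolding B prod.reindex[OF inj] by (simp add: inv_f_f[OF inj] o_def)
qed

text \<open>One family holds both symmetries used below: sign flips, with \<sigma> the identity, and
  coordinate permutations, with all signs 1.\<close>

definition signed_permute :: "('n \<Rightarrow> real) \<Rightarrow> ('n \<Rightarrow> 'n) \<Rightarrow> real ^ 'n \<Rightarrow> real ^ 'n" where
  "signed_permute s \<sigma> y = (\<chi> i. s i * y $ \<sigma> i)"

lemma signed_permute_nth [simp]: "signed_permute s \<sigma> y $ i = s i * y $ \<sigma> i"
  by (simp add: signed_permute_def)

lemma signed_permute_measurable [measurable]: "signed_permute s \<sigma> \<in> borel_measurable borel"
  unfolding signed_permute_def
  by (intro borel_measurable_continuous_onI continuous_intros)

text \<open>Lebesgue measure is determined by its values on boxes, and the preimage of a box is a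
  box whose side lengths are those of the original in another order.\<close>

lemma distr_lborel_signed_permute:
  fixes \<sigma> :: "'n::finite \<Rightarrow> 'n"
  assumes s: "\<And>i. s i \<in> {1, -1}" and \<sigma>: "bij \<sigma>"
  shows "distr lborel borel (signed_permute s \<sigma>) = lborel"
proof (rule lborel_eqI[symmetric])
  fix l u :: "real ^ 'n"
  assume "\<And>b. b \<in> Basis \<Longrightarrow> l \<bullet> b \<le> u \<bullet> b"
  then have le: "l $ i \<le> u $ i" for i
    by (metis axis_in_Basis_iff axis_inverse cart_eq_inner_axis insertI1 real_inner_1_right Basis_real_def)
  define I where "I i x = (indicator {l $ i<..<u $ i} (s i * x) :: ennreal)" for i x
  have [measurable]: "I i \<in> borel_measurable borel" for i
    unfolding I_def by measurable
  have I: "(\<integral>\<^sup>+x. I i x \<partial>lborel) = ennreal (u $ i - l $ i)" for i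
  proof (cases "s i = 1")
    case True
    then show ?thesis using le by (simp add: I_def)
  next
    case False
    then have "I i x = indicator {- u $ i<..<- l $ i} x" for x
      using s[of i] by (auto simp: I_def split: split_indicator)
    then show ?thesis using le[of i] by simp
  qed
  have "emeasure (distr lborel borel (signed_permute s \<sigma>)) (box l u) =
      (\<integral>\<^sup>+y. indicator (box l u) y \<partial>distr lborel borel (signed_permute s \<sigma>))"
    by simp
  also have "\<dots> = (\<integral>\<^sup>+y. indicator (box l u) (signed_permute s \<sigma> y) \<partial>lborel)"
    by (rule nn_integral_distr) auto
  \<comment> \<open>The indicator of a box factors over coordinates. Reindexing by \<sigma> then
    leaves one function of each \<open>y $ i\<close>, as the product formula requires.\<close>
  also have "\<dots> = (\<integral>\<^sup>+y. (\<Prod>i\<in>UNIV. I i (y $ \<sigma> i)) \<partial>lborel)"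
    by (intro nn_integral_cong) (auto simp: I_def mem_box_cart split: split_indicator)
  also have "\<dots> = (\<integral>\<^sup>+y. (\<Prod>i\<in>UNIV. I (inv \<sigma> i) (y $ i)) \<partial>lborel)"
    using prod.reindex_bij_betw[OF \<sigma>, of "\<lambda>i. I (inv \<sigma> i) (y $ i)" for y] \<sigma>
    by (simp add: bij_is_inj)
  also have "\<dots> = (\<Prod>i\<in>UNIV. ennreal (u $ inv \<sigma> i - l $ inv \<sigma> i))"
    by (subst nn_integral_lborel_vec_prod) (auto simp: I)
  also have "\<dots> = (\<Prod>i\<in>UNIV. ennreal (u $ i - l $ i))"
    using prod.reindex_bij_betw[OF bij_imp_bij_inv[OF \<sigma>], of "\<lambda>i. ennreal (u $ i - l $ i)"] by simp
  also have "\<dots> = ennreal (\<Prod>b\<in>Basis. (u - l) \<bullet> b)"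
  proof -
    have inj: "inj (\<lambda>i::'n. axis i (1::real))" by (auto simp: inj_def axis_eq_axis)
    have B: "Basis = range (\<lambda>i::'n. axis i (1::real))" by (auto simp: Basis_vec_def)
    show ?thesis
      unfolding B prod.reindex[OF inj] using le by (simp add: prod_ennreal inner_axis)
  qed
  finally show "emeasure (distr lborel borel (signed_permute s \<sigma>)) (box l u) =
      ennreal (\<Prod>b\<in>Basis. (u - l) \<bullet> b)" .
qed simp

lemma nn_integral_lborel_signed_permute:
  fixes \<sigma> :: "'n::finite \<Rightarrow> 'n"
  assumes "\<And>i. s i \<in> {1, -1}" "bij \<sigma>" "f \<in> borel_measurable borel"
  shows "(\<integral>\<^sup>+y. f (signed_permute s \<sigma> y) \<partial>lborel) = (\<integral>\<^sup>+y. f y \<partial>lborel)"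
  by (subst (2) distr_lborel_signed_permute[OF assms(1,2), symmetric])
    (simp add: nn_integral_distr assms)

section \<open>Measurability of the decoder\<close>

lemma llr_measurable [measurable]:
  assumes "prob_density (q 0)" "prob_density (q 1)"
  shows "llr q \<in> borel_measurable borel"
proof -
  have [measurable]: "q 0 \<in> borel_measurable borel" "q 1 \<in> borel_measurable borel"
    using assms by (auto simp: prob_density_def)
  show ?thesis unfolding llr_def[abs_def] by measurable
qed

lemma reliability_measurable [measurable]:
  assumes [measurable]: "llr q \<in> borel_measurable borel"
  shows "(\<lambda>y. reliability q y i) \<in> borel_measurable borel"
  unfolding reliability_def by measurable

text \<open>The rank is a function of a natural number that counts finitely many measurable
  comparisons, and every function on a discrete space is measurable.\<close>

lemma rank_position_measurable [measurable]:
  assumes [measurable]: "llr q \<in> borel_measurable borel"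
  shows "(\<lambda>y :: real ^ 'n::{finite, linorder}. rank_position q y i) \<in> borel \<rightarrow>\<^sub>M count_space UNIV"
proof -
  define P where "P y j \<longleftrightarrow> reliability q y j < reliability q y i \<or>
      (reliability q y j = reliability q y i \<and> j < i)" for y :: "real ^ 'n::{finite, linorder}" and j
  have [measurable]: "Measurable.pred borel (\<lambda>y. P y j)" for j
    unfolding P_def by measurable
  have "(\<lambda>y. \<Sum>j\<in>UNIV. if P y j then 1 else 0 :: nat) \<in> borel \<rightarrow>\<^sub>M count_space UNIV"
    by measurable
  then have "(\<lambda>y. card {j. P y j}) \<in> borel \<rightarrow>\<^sub>M count_space UNIV"
    by (simp add: sum.If_cases)
  then have "(\<lambda>n. THE r :: 'n. card {j. j < r} = n) \<circ> (\<lambda>y. card {j. P y j}) \<in> borel \<rightarrow>\<^sub>M count_space UNIV"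
    by (rule measurable_comp) simp
  then show ?thesis
    by (simp add: rank_position_def P_def o_def)
qed

lemma candidate_measurable [measurable]:
  assumes [measurable]: "llr q \<in> borel_measurable borel"
  shows "(\<lambda>y. candidate q y e) \<in> borel \<rightarrow>\<^sub>M count_space UNIV"
proof -
  have "Measurable.pred borel (\<lambda>y. candidate q y e = w)" for w
    unfolding candidate_def vec_eq_iff hard_decision_def rank_permute_def
    by simp
  then show ?thesis
    by (subst measurable_count_space_eq2) (auto simp: pred_def vimage_def Int_def)
qed

lemma orb_decode_measurable [measurable]:
  assumes [measurable]: "llr q \<in> borel_measurable borel"
  shows "orb_decode q C es \<in> borel \<rightarrow>\<^sub>M count_space UNIV"
proof (induction es)
  case Nil
  then show ?case by (simp add: orb_decode_def[abs_def])
next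
  case (Cons e es)
  note [measurable] = Cons
  have "orb_decode q C (e # es) =
      (\<lambda>y. if candidate q y e \<in> C then Some (candidate q y e) else orb_decode q C es y)"
    by (auto simp: orb_decode_def)
  also have "\<dots> \<in> borel \<rightarrow>\<^sub>M count_space UNIV"
    by measurable
  finally show ?case .
qed

section \<open>Reduction to the all-zero codeword\<close>

lemma channel_density_measurable [measurable]:
  assumes "\<And>b. prob_density (q b)"
  shows "channel_density q w \<in> borel_measurable borel"
proof -
  have [measurable]: "q b \<in> borel_measurable borel" for b
    using assms by (auto simp: prob_density_def)
  show ?thesis unfolding channel_density_def by measurable
qed

lemma channel_density_nonneg:
  assumes "\<And>b. prob_density (q b)"
  shows "0 \<le> channel_density q w y"
  using assms by (auto simp: channel_density_def prob_density_def intro!: prod_nonneg)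

text \<open>The codeword factor is discrete and countable, so measurability may be checked for each
  fixed codeword.\<close>

lemma measurable_joint_law:
  fixes p :: "(bit ^ 'n) pmf"
  assumes "\<And>w. (\<lambda>y. g (w, y)) \<in> borel \<rightarrow>\<^sub>M K"
  shows "g \<in> measure_pmf p \<Otimes>\<^sub>M (lborel :: (real ^ 'n) measure) \<rightarrow>\<^sub>M K"
proof -
  have "g \<in> count_space UNIV \<Otimes>\<^sub>M (borel :: (real ^ 'n) measure) \<rightarrow>\<^sub>M K"
    using assms by (intro measurable_pair_measure_countable1) auto
  moreover have "sets (measure_pmf p \<Otimes>\<^sub>M (lborel :: (real ^ 'n) measure)) = sets (count_space UNIV \<Otimes>\<^sub>M borel)"
    by (intro sets_pair_measure_cong) auto
  ultimately show ?thesis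
    using measurable_cong_sets by blast
qed

lemma nn_integral_joint_law:
  fixes C :: "(bit ^ 'n) set"
  assumes q: "\<And>b. prob_density (q b)" and C: "C \<noteq> {}"
    and g: "\<And>w. (\<lambda>y. g (w, y)) \<in> borel_measurable borel"
  shows "(\<integral>\<^sup>+z. g z \<partial>joint_law q C) =
    (\<Sum>w\<in>C. \<integral>\<^sup>+y. ennreal (channel_density q w y) * g (w, y) \<partial>lborel) / card C"
proof -
  have [measurable]: "\<And>w. channel_density q w \<in> borel_measurable borel"
    using q by simp
  have [measurable]: "(\<lambda>(w, y). ennreal (channel_density q w y))
      \<in> borel_measurable (measure_pmf (pmf_of_set C) \<Otimes>\<^sub>M lborel)"
    by (rule measurable_joint_law) simp
  have [measurable]: "g \<in> borel_measurable (measure_pmf (pmf_of_set C) \<Otimes>\<^sub>M lborel)"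
    by (rule measurable_joint_law) (use g in simp)
  show ?thesis
    unfolding joint_law_def
    by (subst nn_integral_density)
      (simp_all add: lborel.nn_integral_fst[symmetric] nn_integral_pmf_of_set C)
qed

section \<open>The output law when the zero codeword is sent\<close>

definition noise_law :: "(bit \<Rightarrow> real \<Rightarrow> real) \<Rightarrow> (real ^ 'n) measure" where
  "noise_law q = density lborel (\<lambda>y. ennreal (channel_density q 0 y))"

lemma space_noise_law [simp]: "space (noise_law q) = UNIV"
  by (simp add: noise_law_def)

lemma sets_noise_law [simp, measurable_cong]: "sets (noise_law q) = sets borel"
  by (simp add: noise_law_def)

text \<open>Under this law the coordinates are independent, each with density
  \<open>q 0\<close>.\<close>

lemma nn_integral_noise_law_prod:
  fixes f :: "'n::finite \<Rightarrow> real \<Rightarrow> ennreal"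
  assumes q: "\<And>b. prob_density (q b)" and [measurable]: "\<And>i. f i \<in> borel_measurable borel"
  shows "(\<integral>\<^sup>+y. (\<Prod>i\<in>UNIV. f i (y $ i)) \<partial>noise_law q) = (\<Prod>i\<in>UNIV. \<integral>\<^sup>+x. q 0 x * f i x \<partial>lborel)"
proof -
  have [measurable]: "q b \<in> borel_measurable borel" "channel_density q w \<in> borel_measurable borel" for b w
    using q by (auto simp: prob_density_def)
  have "(\<integral>\<^sup>+y. (\<Prod>i\<in>UNIV. f i (y $ i)) \<partial>noise_law q) =
      (\<integral>\<^sup>+y. ennreal (channel_density q 0 y) * (\<Prod>i\<in>UNIV. f i (y $ i)) \<partial>lborel)"
    unfolding noise_law_def by (subst nn_integral_density) auto
  also have "\<dots> = (\<integral>\<^sup>+y. (\<Prod>i\<in>UNIV. ennreal (q 0 (y $ i)) * f i (y $ i)) \<partial>lborel)"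
    using q by (intro nn_integral_cong)
      (auto simp: channel_density_def prob_density_def prod.distrib prod_ennreal)
  also have "\<dots> = (\<Prod>i\<in>UNIV. \<integral>\<^sup>+x. q 0 x * f i x \<partial>lborel)"
    by (rule nn_integral_lborel_vec_prod[where f="\<lambda>i x. ennreal (q 0 x) * f i x"]) auto
  finally show ?thesis .
qed

lemma prob_space_noise_law:
  assumes "\<And>b. prob_density (q b)"
  shows "prob_space (noise_law q :: (real ^ 'n) measure)"
proof
  have "emeasure (noise_law q) (space (noise_law q :: (real ^ 'n) measure)) =
      (\<integral>\<^sup>+y. (\<Prod>i\<in>(UNIV :: 'n set). 1) \<partial>(noise_law q :: (real ^ 'n) measure))"
    by simp
  also have "\<dots> = 1"
    using assms by (subst nn_integral_noise_law_prod) (auto simp: prob_density_def)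
  finally show "emeasure (noise_law q) (space (noise_law q :: (real ^ 'n) measure)) = 1" .
qed

section \<open>Sign flips and coordinate permutations of the output\<close>

definition codeword_flip :: "bit ^ 'n \<Rightarrow> real ^ 'n \<Rightarrow> real ^ 'n" where
  "codeword_flip w = signed_permute (\<lambda>i. if w $ i = 0 then 1 else -1) id"

definition coordinate_permute :: "('n \<Rightarrow> 'n) \<Rightarrow> real ^ 'n \<Rightarrow> real ^ 'n" where
  "coordinate_permute = signed_permute (\<lambda>_. 1)"

lemma codeword_flip_measurable [measurable]: "codeword_flip w \<in> borel_measurable borel"
  by (simp add: codeword_flip_def)

lemma coordinate_permute_measurable [measurable]: "coordinate_permute \<sigma> \<in> borel_measurable borel"
  by (simp add: coordinate_permute_def)

lemma codeword_flip_nth: "codeword_flip w y $ i = (if w $ i = 0 then y $ i else - (y $ i))"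
  by (simp add: codeword_flip_def)

lemma coordinate_permute_nth [simp]: "coordinate_permute \<sigma> y $ i = y $ \<sigma> i"
  by (simp add: coordinate_permute_def)

text \<open>Exchangeability: the density is a product with the same factor \<open>q 0\<close> in
  every coordinate, and Lebesgue measure is invariant.\<close>

lemma nn_integral_noise_law_permute:
  fixes \<sigma> :: "'n::finite \<Rightarrow> 'n"
  assumes q: "\<And>b. prob_density (q b)" and \<sigma>: "bij \<sigma>" and [measurable]: "f \<in> borel_measurable borel"
  shows "(\<integral>\<^sup>+y. f (coordinate_permute \<sigma> y) \<partial>noise_law q) = (\<integral>\<^sup>+y. f y \<partial>noise_law q)"
proof -
  have [measurable]: "\<And>w. channel_density q w \<in> borel_measurable borel"
    using q by simp
  have inv: "channel_density q 0 (coordinate_permute \<sigma> y) = channel_density q 0 y" for y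
    using prod.reindex_bij_betw[OF \<sigma>, of "\<lambda>i. q 0 (y $ i)"] by (simp add: channel_density_def)
  have "(\<integral>\<^sup>+y. f (coordinate_permute \<sigma> y) \<partial>noise_law q) =
      (\<integral>\<^sup>+y. ennreal (channel_density q 0 (coordinate_permute \<sigma> y)) * f (coordinate_permute \<sigma> y) \<partial>lborel)"
    unfolding noise_law_def by (subst nn_integral_density) (auto simp: inv)
  also have "\<dots> = (\<integral>\<^sup>+y. ennreal (channel_density q 0 y) * f y \<partial>lborel)"
    unfolding coordinate_permute_def
    using \<sigma> by (intro nn_integral_lborel_signed_permute[where f="\<lambda>y. ennreal (channel_density q 0 y) * f y"]) auto
  also have "\<dots> = (\<integral>\<^sup>+y. f y \<partial>noise_law q)"
    unfolding noise_law_def by (subst nn_integral_density) auto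
  finally show ?thesis .
qed

text \<open>Negating the output swaps the two densities and so inverts their ratio; the infinite
  values and the default \<open>0\<close> obey the same rule.\<close>

lemma llr_minus:
  assumes q: "\<And>b. prob_density (q b)" and sym: "output_symmetric q"
  shows "llr q (- y) = - llr q y"
proof -
  have eq: "q 0 (- y) = q 1 y" "q 1 (- y) = q 0 y"
    using sym by (auto simp: output_symmetric_def)
  have "0 \<le> q b y" for b
    using q by (auto simp: prob_density_def)
  then have "q b y \<noteq> 0 \<Longrightarrow> 0 < q b y" for b
    by (simp add: order_less_le)
  then show ?thesis
    by (auto simp: llr_def eq ln_div)
qed

lemma bit_vec_add_self [simp]: "x + x = (0 :: bit ^ 'n)"
proof -
  have "b + b = 0" for b :: bit by (cases b) simp_all
  then show ?thesis by (simp add: vec_eq_iff)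
qed

lemma bit_vec_add_eq_0_iff: "x + y = 0 \<longleftrightarrow> x = (y :: bit ^ 'n)"
  by (metis add.assoc add.left_neutral add.right_neutral bit_vec_add_self)

text \<open>A sign flip keeps all reliabilities, hence all ranks, and toggles the hard decision
  exactly where \<open>w\<close> is 1. The toggling relies on \<open>nz\<close>: a ratio of zero is
  decided as 0 both before and after the flip.\<close>

lemma candidate_flip:
  assumes q: "\<And>b. prob_density (q b)" "output_symmetric q" and nz: "\<And>i. llr q (y $ i) \<noteq> 0"
  shows "candidate q (codeword_flip w y) e = w + candidate q y e"
proof -
  have rel: "reliability q (codeword_flip w y) = reliability q y"
    by (auto simp: reliability_def codeword_flip_nth llr_minus[OF q])
  have "hard_decision q (codeword_flip w y) $ i = (w + hard_decision q y) $ i" for i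
    using nz[of i] llr_minus[OF q, of "y $ i"]
    by (cases "w $ i") (auto simp: hard_decision_def codeword_flip_nth not_less order_less_le)
  then have "hard_decision q (codeword_flip w y) = w + hard_decision q y"
    by (simp add: vec_eq_iff)
  moreover have "rank_permute q (codeword_flip w y) e = rank_permute q y e"
    by (simp add: rank_permute_def rank_position_def rel)
  ultimately show ?thesis by (simp add: candidate_def add.assoc)
qed

text \<open>Without ties the index order never enters the comparison, so permuting the coordinates
  merely relabels the set that is counted.\<close>

lemma rank_position_permute:
  fixes y :: "real ^ 'n::{finite, linorder}"
  assumes \<sigma>: "bij \<sigma>" and inj: "inj (reliability q y)"
  shows "rank_position q (coordinate_permute \<sigma> y) i = rank_position q y (\<sigma> i)"
proof -
  define r where "r = reliability q y"
  have rel: "reliability q (coordinate_permute \<sigma> y) j = r (\<sigma> j)" for j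
    by (simp add: reliability_def r_def)
  have r: "r a = r b \<longleftrightarrow> a = b" for a b
    using inj by (auto simp: r_def dest: injD)
  have s: "\<sigma> a = \<sigma> b \<longleftrightarrow> a = b" for a b
    using \<sigma> by (auto simp: bij_def dest: injD)
  have "{j. r j < r (\<sigma> i)} = \<sigma> ` {j. r (\<sigma> j) < r (\<sigma> i)}"
    using \<sigma> by (auto simp: bij_def surj_def image_iff)
  then have "card {j. r j < r (\<sigma> i)} = card {j. r (\<sigma> j) < r (\<sigma> i)}"
    using \<sigma> by (metis bij_is_inj card_image inj_on_subset subset_UNIV)
  moreover have "{j. r j < r k \<or> r j = r k \<and> j < k} = {j. r j < r k}"
    "{j. r (\<sigma> j) < r (\<sigma> k) \<or> r (\<sigma> j) = r (\<sigma> k) \<and> j < k} = {j. r (\<sigma> j) < r (\<sigma> k)}" for k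
    by (auto simp: r s)
  ultimately show ?thesis
    unfolding rank_position_def rel r_def[symmetric] by simp
qed

lemma candidate_permute:
  fixes y :: "real ^ 'n::{finite, linorder}"
  assumes "bij \<sigma>" "inj (reliability q y)"
  shows "candidate q (coordinate_permute \<sigma> y) e = (\<chi> i. candidate q y e $ \<sigma> i)"
  by (simp add: candidate_def vec_eq_iff hard_decision_def rank_permute_def rank_position_permute[OF assms])

section \<open>Output-symmetric channels with a linear code\<close>

locale symmetric_channel_code =
  fixes q :: "bit \<Rightarrow> real \<Rightarrow> real" and C :: "(bit ^ 'n::{finite, linorder}) set"
  assumes prob_density: "prob_density (q b)"
    and symmetric: "output_symmetric q"
    and subspace: "vec.subspace C"
    and atomless: "atomless_reliabilities q C"
begin

lemma zero_in_code: "0 \<in> C"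
  using subspace by (rule vec.subspace_0)

lemma code_add_iff: "w \<in> C \<Longrightarrow> w + c \<in> C \<longleftrightarrow> c \<in> C"
  using vec.subspace_add[OF subspace] vec.subspace_diff[OF subspace] by fastforce

lemma code_nonempty: "C \<noteq> {}"
  using zero_in_code by auto

lemma channel_measurable [measurable]:
  "q b \<in> borel_measurable borel" "llr q \<in> borel_measurable borel"
  "channel_density q w \<in> borel_measurable borel"
  using prob_density by (auto simp: prob_density_def)

sublocale noise: prob_space "noise_law q :: ((real, 'n) vec) measure"
  using prob_density by (rule prob_space_noise_law)

text \<open>Atomlessness is assumed for the output of a random codeword. That law is a uniform
  mixture over the code, and the zero codeword contributes one component.\<close>

lemma noise_reliability_atomless:
  "emeasure (noise_law q) {y :: (real, 'n) vec. reliability q y i = x} = 0"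
proof -
  define A where "A = {y :: (real, 'n) vec. reliability q y i = x}"
  have [measurable]: "A \<in> sets borel" unfolding A_def by measurable
  have [measurable]: "snd \<in> joint_law q C \<rightarrow>\<^sub>M borel"
    unfolding joint_law_def using measurable_joint_law[of snd borel "pmf_of_set C"] by simp
  have "0 = emeasure (distr (output_law q C) borel (\<lambda>y. reliability q y i)) {x}"
    using atomless by (simp add: atomless_reliabilities_def)
  also have "\<dots> = emeasure (output_law q C) A"
    by (subst emeasure_distr) (auto simp: output_law_def A_def vimage_def)
  also have "\<dots> = (\<integral>\<^sup>+y. indicator A y \<partial>output_law q C)"
    by (simp add: output_law_def)
  also have "\<dots> = (\<integral>\<^sup>+z. indicator A (snd z) \<partial>joint_law q C)"
    unfolding output_law_def by (rule nn_integral_distr) auto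
  also have "\<dots> = (\<Sum>w\<in>C. \<integral>\<^sup>+y. ennreal (channel_density q w y) * indicator A y \<partial>lborel) / card C"
    using prob_density code_nonempty by (subst nn_integral_joint_law) auto
  finally have "(\<Sum>w\<in>C. \<integral>\<^sup>+y. ennreal (channel_density q w y) * indicator A y \<partial>lborel) / card C = 0"
    by simp
  \<comment> \<open>A finite sum of nonnegative terms is zero only if each term is, in particular
    the one for \<open>w = 0\<close>.\<close>
  then have "(\<integral>\<^sup>+y. ennreal (channel_density q 0 y) * indicator A y \<partial>lborel) = 0"
    using zero_in_code by (auto simp: ennreal_divide_eq_0_iff)
  then show ?thesis
    by (simp add: noise_law_def emeasure_density A_def)
qed

lemma AE_llr_nonzero: "AE y in (noise_law q :: ((real, 'n) vec) measure). \<forall>i. llr q (y $ i) \<noteq> 0"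
proof -
  have "AE y in (noise_law q :: ((real, 'n) vec) measure). llr q (y $ i) \<noteq> 0" for i
    by (rule AE_I[OF _ noise_reliability_atomless[of i 0]]) (auto simp: reliability_def)
  then show ?thesis by (simp add: AE_all_countable)
qed

text \<open>Two distinct coordinates are independent with density \<open>q 0\<close>. Stating this
  as a product measure makes Fubini available for excluding ties.\<close>

lemma noise_pair_law:
  assumes "i \<noteq> j"
  shows "density lborel (q 0) \<Otimes>\<^sub>M density lborel (q 0) =
    distr (noise_law q :: ((real, 'n) vec) measure) (borel \<Otimes>\<^sub>M borel) (\<lambda>y. (y $ i, y $ j))"
proof (rule pair_measure_eqI)
  have prob: "prob_space (density lborel (q 0))"
    using prob_density[of 0] by (intro prob_spaceI) (simp add: emeasure_density prob_density_def)
  then show "sigma_finite_measure (density lborel (q 0))" "sigma_finite_measure (density lborel (q 0))"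
    by (simp_all add: prob_space_imp_sigma_finite)
  fix A B assume "A \<in> sets (density lborel (q 0))" "B \<in> sets (density lborel (q 0))"
  then have [measurable]: "A \<in> sets borel" "B \<in> sets borel" by auto
  \<comment> \<open>All coordinates other than \<open>i\<close> and \<open>j\<close> get the factor
    1, whose integral against \<open>q 0\<close> is 1.\<close>
  define I :: "'n \<Rightarrow> real \<Rightarrow> ennreal" where
    "I k = (if k = i then indicator A else if k = j then indicator B else (\<lambda>_. 1))" for k
  have [measurable]: "I k \<in> borel_measurable borel" for k
    by (simp add: I_def)
  have split: "(\<Prod>k\<in>UNIV. f k) = f i * f j" if "\<And>k. k \<noteq> i \<Longrightarrow> k \<noteq> j \<Longrightarrow> f k = (1 :: ennreal)" for f
  proof -
    have "(\<Prod>k\<in>UNIV. f k) = (\<Prod>k\<in>{i, j}. f k)"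
      using that by (intro prod.mono_neutral_right) auto
    then show ?thesis using assms by simp
  qed
  have "emeasure (distr (noise_law q) (borel \<Otimes>\<^sub>M borel) (\<lambda>y :: (real, 'n) vec. (y $ i, y $ j))) (A \<times> B) =
      (\<integral>\<^sup>+z. indicator (A \<times> B) z \<partial>distr (noise_law q) (borel \<Otimes>\<^sub>M borel) (\<lambda>y :: (real, 'n) vec. (y $ i, y $ j)))"
    by simp
  also have "\<dots> = (\<integral>\<^sup>+y. indicator (A \<times> B) (y $ i, y $ j) \<partial>(noise_law q :: ((real, 'n) vec) measure))"
    by (rule nn_integral_distr) auto
  also have "\<dots> = (\<integral>\<^sup>+y. (\<Prod>k\<in>UNIV. I k (y $ k)) \<partial>noise_law q)"
    using assms by (subst split) (auto simp: I_def indicator_times)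
  also have "\<dots> = (\<Prod>k\<in>UNIV. \<integral>\<^sup>+x. q 0 x * I k x \<partial>lborel)"
    using prob_density by (rule nn_integral_noise_law_prod) simp
  also have "\<dots> = (\<integral>\<^sup>+x. q 0 x * I i x \<partial>lborel) * (\<integral>\<^sup>+x. q 0 x * I j x \<partial>lborel)"
    using prob_density[of 0] by (intro split) (auto simp: I_def prob_density_def)
  also have "\<dots> = emeasure (density lborel (q 0)) A * emeasure (density lborel (q 0)) B"
    using assms by (simp add: I_def emeasure_density)
  finally show "emeasure (density lborel (q 0)) A * emeasure (density lborel (q 0)) B =
      emeasure (distr (noise_law q) (borel \<Otimes>\<^sub>M borel) (\<lambda>y :: (real, 'n) vec. (y $ i, y $ j))) (A \<times> B)" ..
next
  show "sets (density lborel (q 0) \<Otimes>\<^sub>M density lborel (q 0)) =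
      sets (distr (noise_law q) (borel \<Otimes>\<^sub>M borel) (\<lambda>y :: (real, 'n) vec. (y $ i, y $ j)))"
    by (simp cong: sets_pair_measure_cong)
qed

text \<open>With coordinate \<open>i\<close> fixed, the independent coordinate \<open>j\<close>
  attains the same reliability with probability zero, as that would be an atom. Fubini and the
  finiteness of the set of pairs give the claim.\<close>

lemma AE_reliability_inj: "AE y in (noise_law q :: ((real, 'n) vec) measure). inj (reliability q y)"
proof -
  have "AE y in noise_law q. reliability q y i \<noteq> reliability q y j" if "i \<noteq> j" for i j :: 'n
  proof -
    let ?N = "density lborel (q 0)"
    interpret N: prob_space ?N
      using prob_density[of 0] by (intro prob_spaceI) (simp add: emeasure_density prob_density_def)
    interpret NN: pair_sigma_finite ?N ?N ..
    have slice: "AE b in ?N. \<bar>llr q a\<bar> \<noteq> \<bar>llr q b\<bar>" for a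
    proof -
      have "emeasure ?N {b. \<bar>llr q b\<bar> = x} = 0" for x
      proof -
        have [measurable]: "{b. \<bar>llr q b\<bar> = x} \<in> sets borel" by measurable
        \<comment> \<open>The factor 1 turns the event into a rectangle of the pair law, where the
          atomlessness of coordinate \<open>j\<close> of the whole vector applies.\<close>
        have "emeasure ?N {b. \<bar>llr q b\<bar> = x} = emeasure ?N UNIV * emeasure ?N {b. \<bar>llr q b\<bar> = x}"
          using N.emeasure_space_1 by simp
        also have "\<dots> = emeasure (?N \<Otimes>\<^sub>M ?N) (UNIV \<times> {b. \<bar>llr q b\<bar> = x})"
          by (rule N.emeasure_pair_measure_Times[symmetric]) auto
        also have "\<dots> = emeasure (noise_law q) {y :: (real, 'n) vec. reliability q y j = x}"
          unfolding noise_pair_law[OF that]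
          by (subst emeasure_distr) (auto simp: reliability_def vimage_def)
        finally show ?thesis by (simp add: noise_reliability_atomless)
      qed
      then show ?thesis
        by (intro AE_I[of _ _ "{b. \<bar>llr q b\<bar> = \<bar>llr q a\<bar>}"]) auto
    qed
    have "AE z in ?N \<Otimes>\<^sub>M ?N. \<bar>llr q (fst z)\<bar> \<noteq> \<bar>llr q (snd z)\<bar>"
    proof (rule NN.AE_pair_measure)
      have "Measurable.pred (borel \<Otimes>\<^sub>M borel) (\<lambda>z. \<bar>llr q (fst z)\<bar> \<noteq> \<bar>llr q (snd z)\<bar>)"
        by measurable
      then show "{z \<in> space (?N \<Otimes>\<^sub>M ?N). \<bar>llr q (fst z)\<bar> \<noteq> \<bar>llr q (snd z)\<bar>} \<in> sets (?N \<Otimes>\<^sub>M ?N)"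
        by (simp add: pred_def space_pair_measure cong: sets_pair_measure_cong)
    qed (use slice in simp)
    then show ?thesis
      unfolding noise_pair_law[OF that]
      by (subst (asm) AE_distr_iff) (auto simp: reliability_def)
  qed
  then have "AE y in noise_law q. \<forall>i j :: 'n. i \<noteq> j \<longrightarrow> reliability q y i \<noteq> reliability q y j"
    by (simp add: AE_all_countable)
  then show ?thesis
    by eventually_elim (auto simp: inj_def)
qed

section \<open>Transfer from a random codeword to the zero codeword\<close>

text \<open>In the summand of \<open>w\<close>, substitute the flip by \<open>w\<close>: output
  symmetry turns the density of \<open>w\<close> into that of the zero word, and \<open>inv\<close>
  does the same for the integrand. All \<open>card C\<close> summands then coincide and the average
  disappears.\<close>

lemma nn_integral_joint_law_flip:
  assumes g: "\<And>w. (\<lambda>y. g (w, y)) \<in> borel_measurable borel"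
    and inv: "AE y in noise_law q. \<forall>w\<in>C. g (w, codeword_flip w y) = g (0, y)"
  shows "(\<integral>\<^sup>+z. g z \<partial>joint_law q C) = (\<integral>\<^sup>+y. g (0, y) \<partial>noise_law q)"
proof -
  note [measurable] = g
  have density_flip: "channel_density q w (codeword_flip w y) = channel_density q 0 y" for w and y :: "(real, 'n) vec"
    unfolding channel_density_def
  proof (rule prod.cong)
    fix i
    show "q (w $ i) (codeword_flip w y $ i) = q (0 $ i) (y $ i)"
      using symmetric by (cases "w $ i") (auto simp: codeword_flip_nth output_symmetric_def)
  qed simp
  have "(\<integral>\<^sup>+y. ennreal (channel_density q w y) * g (w, y) \<partial>lborel) = (\<integral>\<^sup>+y. g (0, y) \<partial>noise_law q)"
    if w: "w \<in> C" for w
  proof -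
    have "(\<integral>\<^sup>+y. ennreal (channel_density q w y) * g (w, y) \<partial>lborel) =
        (\<integral>\<^sup>+y. ennreal (channel_density q w (codeword_flip w y)) * g (w, codeword_flip w y) \<partial>lborel)"
      unfolding codeword_flip_def
      by (rule nn_integral_lborel_signed_permute[symmetric,
            where f="\<lambda>y. ennreal (channel_density q w y) * g (w, y)"]) auto
    also have "\<dots> = (\<integral>\<^sup>+y. g (w, codeword_flip w y) \<partial>noise_law q)"
      unfolding noise_law_def by (subst nn_integral_density) (auto simp: density_flip)
    also have "\<dots> = (\<integral>\<^sup>+y. g (0, y) \<partial>noise_law q)"
      using inv w by (intro nn_integral_cong_AE) auto
    finally show ?thesis .
  qed
  then have "(\<integral>\<^sup>+z. g z \<partial>joint_law q C) = of_nat (card C) * (\<integral>\<^sup>+y. g (0, y) \<partial>noise_law q) / card C"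
    using prob_density code_nonempty g by (subst nn_integral_joint_law) auto
  also have "\<dots> = (\<integral>\<^sup>+y. g (0, y) \<partial>noise_law q)"
    using code_nonempty by (subst mult.commute, subst ennreal_mult_divide_eq) auto
  finally show ?thesis .
qed

text \<open>The flip adds \<open>w\<close> to every candidate. Since \<open>w\<close> is a codeword,
  each membership test has the same outcome, so the decoded word is translated by
  \<open>w\<close>.\<close>

lemma orb_decode_flip:
  assumes "w \<in> C" "\<And>i. llr q (y $ i) \<noteq> 0"
  shows "orb_decode q C es (codeword_flip w y) = Some w \<longleftrightarrow> orb_decode q C es y = Some 0"
proof -
  have "orb_decode q C es (codeword_flip w y) = map_option ((+) w) (orb_decode q C es y)"
    by (induction es) (auto simp: orb_decode_def candidate_flip[OF prob_density symmetric assms(2)]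
        code_add_iff[OF assms(1)])
  then show ?thesis
    by (cases "orb_decode q C es y") auto
qed

lemma success_prob_eq:
  "success_prob q C es = measure (noise_law q) {y. orb_decode q C es y = Some 0}"
proof -
  define A where "A = {(w, y) \<in> space (joint_law q C). orb_decode q C es y = Some w}"
  define g where "g z = (of_bool (orb_decode q C es (snd z) = Some (fst z)) :: ennreal)" for z
  have space: "space (joint_law q C) = UNIV"
    by (simp add: joint_law_def space_pair_measure)
  have meas: "(\<lambda>y. g (w, y)) \<in> borel_measurable borel" for w
    unfolding g_def by simp
  have "g \<in> borel_measurable (joint_law q C)"
    unfolding joint_law_def using measurable_joint_law[of g borel "pmf_of_set C"] meas by simp
  then have "g -` {1} \<inter> space (joint_law q C) \<in> sets (joint_law q C)"
    by (rule measurable_sets) simp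
  also have "g -` {1} \<inter> space (joint_law q C) = A"
    by (auto simp: A_def g_def)
  finally have "emeasure (joint_law q C) A = (\<integral>\<^sup>+z. indicator A z \<partial>joint_law q C)"
    by simp
  also have "\<dots> = (\<integral>\<^sup>+z. g z \<partial>joint_law q C)"
    by (intro nn_integral_cong) (auto simp: A_def g_def space indicator_def)
  also have "\<dots> = (\<integral>\<^sup>+y. g (0, y) \<partial>noise_law q)"
  proof (rule nn_integral_joint_law_flip[OF meas])
    show "AE y in noise_law q. \<forall>w\<in>C. g (w, codeword_flip w y) = g (0, y)"
      using AE_llr_nonzero by eventually_elim (simp add: g_def orb_decode_flip)
  qed
  also have "\<dots> = (\<integral>\<^sup>+y. indicator {y. orb_decode q C es y = Some 0} y \<partial>noise_law q)"
    by (intro nn_integral_cong) (auto simp: g_def indicator_def)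
  also have "\<dots> = emeasure (noise_law q) {y. orb_decode q C es y = Some 0}"
    by (intro nn_integral_indicator) measurable
  finally show ?thesis
    by (simp add: success_prob_def measure_def A_def)
qed

text \<open>With the zero word sent, the candidate is zero exactly when the hard decision equals the
  permuted pattern, that is, when \<open>e\<close> is the true noise pattern.\<close>

definition pattern_prob :: "(bit, 'n) vec \<Rightarrow> real" where
  "pattern_prob e = measure (noise_law q) {y. candidate q y e = 0}"

text \<open>The expected posterior of the candidate is the probability that it equals the sent
  codeword, and this event is invariant under codeword flips.\<close>

lemma p_seq_eq: "p_seq q C es t = pattern_prob (es ! t)"
proof -
  define e where "e = es ! t"
  define f where "f y = posterior q C y (candidate q y e)" for y
  have f_nonneg: "0 \<le> f y" for y
    unfolding f_def posterior_def
    by (intro divide_nonneg_nonneg mult_nonneg_nonneg sum_nonneg channel_density_nonneg prob_density) auto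
  have "(\<lambda>y. posterior q C y w) \<in> borel_measurable borel" for w
    unfolding posterior_def by measurable
  then have [measurable]: "f \<in> borel_measurable borel"
    unfolding f_def by (rule measurable_compose_countable) simp
  have [measurable]: "snd \<in> joint_law q C \<rightarrow>\<^sub>M borel"
    unfolding joint_law_def using measurable_joint_law[of snd borel "pmf_of_set C"] by simp
  \<comment> \<open>Multiplying the posterior by its denominator leaves the density at the candidate
    if that is a codeword, and zero otherwise; the uniform prior cancels.\<close>
  have ptw: "(\<Sum>w\<in>C. ennreal (channel_density q w y) * ennreal (f y)) =
      (\<Sum>w\<in>C. ennreal (channel_density q w y) * of_bool (candidate q y e = w))" for y
  proof -
    let ?c = "candidate q y e" and ?d = "\<lambda>w. channel_density q w y"
    have d: "0 \<le> ?d w" for w by (intro channel_density_nonneg prob_density)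
    have "f y * (\<Sum>w\<in>C. ?d w) = of_bool (?c \<in> C) * ?d ?c"
    proof (cases "(\<Sum>w\<in>C. ?d w) = 0")
      \<comment> \<open>All codeword densities vanish at this output, so both sides are
        zero.\<close>
      case True
      then have "?c \<in> C \<Longrightarrow> ?d ?c = 0"
        using d by (subst (asm) sum_nonneg_eq_0_iff) auto
      with True show ?thesis by auto
    next
      case False
      then show ?thesis
        using code_nonempty
        by (simp add: f_def posterior_def sum_divide_distrib[symmetric] indicator_def)
    qed
    moreover have "(\<Sum>w\<in>C. ennreal (?d w) * ennreal (f y)) = ennreal (f y * (\<Sum>w\<in>C. ?d w))"
      using d f_nonneg by (simp add: ennreal_mult'[symmetric] sum_distrib_left mult.commute)
    moreover have "(\<Sum>w\<in>C. ennreal (?d w) * of_bool (?c = w)) = ennreal (of_bool (?c \<in> C) * ?d ?c)"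
      by (simp add: of_bool_def if_distrib cong: if_cong)
    ultimately show ?thesis by simp
  qed
  have mixture: "(\<integral>\<^sup>+z. h (fst z) (snd z) \<partial>joint_law q C) =
      (\<integral>\<^sup>+y. (\<Sum>w\<in>C. ennreal (channel_density q w y) * h w y) \<partial>lborel) / card C"
    if [measurable]: "\<And>w. h w \<in> borel_measurable borel" for h
    using prob_density code_nonempty
    by (subst nn_integral_joint_law) (auto simp: nn_integral_sum)
  have "(\<integral>\<^sup>+y. ennreal (f y) \<partial>output_law q C) = (\<integral>\<^sup>+z. ennreal (f (snd z)) \<partial>joint_law q C)"
    unfolding output_law_def by (rule nn_integral_distr) auto
  also have "\<dots> = (\<integral>\<^sup>+y. (\<Sum>w\<in>C. ennreal (channel_density q w y) * ennreal (f y)) \<partial>lborel) / card C"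
    by (rule mixture) simp
  also have "\<dots> = (\<integral>\<^sup>+z. of_bool (candidate q (snd z) e = fst z) \<partial>joint_law q C)"
    unfolding ptw by (rule mixture[symmetric]) simp
  also have "\<dots> = (\<integral>\<^sup>+y. of_bool (candidate q y e = 0) \<partial>noise_law q)"
  proof (subst nn_integral_joint_law_flip)
    show "AE y in noise_law q. \<forall>w\<in>C. (of_bool (candidate q (snd (w, codeword_flip w y)) e =
        fst (w, codeword_flip w y)) :: ennreal) = of_bool (candidate q (snd (0, y)) e = fst (0, y))"
      using AE_llr_nonzero
      by eventually_elim (simp add: candidate_flip[OF prob_density symmetric])
  qed auto
  also have "\<dots> = (\<integral>\<^sup>+y. indicator {y. candidate q y e = 0} y \<partial>noise_law q)"
    by (intro nn_integral_cong) (auto simp: indicator_def)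
  also have "\<dots> = emeasure (noise_law q) {y. candidate q y e = 0}"
    by (intro nn_integral_indicator) measurable
  finally have "(\<integral>\<^sup>+y. ennreal (f y) \<partial>output_law q C) = emeasure (noise_law q) {y. candidate q y e = 0}" .
  moreover have "p_seq q C es t = enn2real (\<integral>\<^sup>+y. ennreal (f y) \<partial>output_law q C)"
    unfolding p_seq_def f_def[symmetric] e_def[symmetric]
    using f_nonneg by (intro integral_eq_nn_integral) (auto simp: output_law_def)
  ultimately show ?thesis
    by (simp add: pattern_prob_def measure_def e_def)
qed

section \<open>Cosets seen through the rank permutation\<close>

text \<open>Sums are differences over \<open>bit\<close>, so this is congruence modulo the subspace
  of vectors that rearrangement by \<tau> carries into \<open>C\<close>.\<close>

definition coset_rel :: "('n \<Rightarrow> 'n) \<Rightarrow> (bit, 'n) vec \<Rightarrow> (bit, 'n) vec \<Rightarrow> bool" where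
  "coset_rel \<tau> x e \<longleftrightarrow> (\<chi> i. (x + e) $ \<tau> i) \<in> C"

lemma equivp_coset_rel: "equivp (coset_rel \<tau>)"
proof (rule equivpI)
  show "reflp (coset_rel \<tau>)"
    using zero_in_code by (auto simp: reflp_def coset_rel_def zero_vec_def)
  show "symp (coset_rel \<tau>)"
    by (auto simp: symp_def coset_rel_def add.commute)
  show "transp (coset_rel \<tau>)"
  proof (rule transpI)
    fix x y z assume "coset_rel \<tau> x y" "coset_rel \<tau> y z"
    then have "(\<chi> i. (x + y) $ \<tau> i) + (\<chi> i. (y + z) $ \<tau> i) \<in> C"
      using code_add_iff unfolding coset_rel_def by blast
    \<comment> \<open>The two copies of \<open>y\<close> are grouped so that they cancel in
      characteristic two.\<close>
    also have "(\<chi> i. (x + y) $ \<tau> i) + (\<chi> i. (y + z) $ \<tau> i) = (\<chi> i. (x + (y + y) + z) $ \<tau> i)"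
      by (simp only: vec_eq_iff vec_lambda_beta vector_add_component add.assoc simp_thms)
    finally show "coset_rel \<tau> x z"
      by (simp add: coset_rel_def)
  qed
qed

text \<open>The hard decisions cancel, so the difference of two candidates depends on the output
  only through its ranks.\<close>

lemma candidate_add:
  "candidate q y x + candidate q y e = (\<chi> i. (x + e) $ rank_position q y i)"
proof -
  have "candidate q y x + candidate q y e =
      (hard_decision q y + hard_decision q y) + (rank_permute q y x + rank_permute q y e)"
    unfolding candidate_def by (simp only: ac_simps)
  then show ?thesis
    by (simp add: rank_permute_def vec_eq_iff)
qed

lemma candidate_inj:
  assumes "candidate q y x = candidate q y e"
  shows "x = e"
proof -
  have zero: "(x + e) $ rank_position q y i = 0" for i
    using candidate_add[of y x e] assms by (simp add: vec_eq_iff)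
  have "(x + e) $ j = 0" for j
  proof -
    obtain i where "j = rank_position q y i"
      using bij_rank_position[of q y] by (auto elim: bij_pointE)
    with zero show ?thesis by metis
  qed
  then have "x + e = 0"
    by (simp only: vec_eq_iff zero_index simp_thms)
  then show ?thesis
    by (simp only: bit_vec_add_eq_0_iff)
qed

text \<open>If the candidate of \<open>e\<close> is zero, any other candidate equals its sum with
  it, namely \<open>x + e\<close> rearranged. It is a codeword exactly when \<open>x\<close> lies in
  the coset of \<open>e\<close>, so the decoder returns zero iff \<open>e\<close> leads its
  coset.\<close>

lemma orb_decode_permute:
  assumes \<sigma>: "bij \<sigma>" and inj: "inj (reliability q y)"
  shows "orb_decode q C es (coordinate_permute \<sigma> y) = Some 0 \<longleftrightarrow>
    (\<exists>e\<in>set es. candidate q y e = 0 \<and> class_leader (coset_rel (rank_position q y \<circ> \<sigma>)) es e)"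
proof -
  define f where "f e = candidate q (coordinate_permute \<sigma> y) e" for e
  have f_eta: "candidate q (coordinate_permute \<sigma> y) = f"
    by (simp add: fun_eq_iff f_def)
  have f: "f e = (\<chi> i. candidate q y e $ \<sigma> i)" for e
    unfolding f_def by (rule candidate_permute[OF \<sigma> inj])
  have f_0: "f e = 0 \<longleftrightarrow> candidate q y e = 0" for e
    using \<sigma> by (simp add: f vec_eq_iff) (metis bij_pointE)
  have f_add: "f x + f e = (\<chi> i. (x + e) $ (rank_position q y \<circ> \<sigma>) i)" for x e
  proof -
    have "f x + f e = (\<chi> i. (candidate q y x + candidate q y e) $ \<sigma> i)"
      by (simp add: f vec_eq_iff)
    then show ?thesis by (simp add: candidate_add)
  qed
  have "f x \<in> C \<longleftrightarrow> coset_rel (rank_position q y \<circ> \<sigma>) x e" if "f e = 0" for x e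
    using f_add[of x e] that by (simp add: coset_rel_def)
  then have leader: "class_leader (coset_rel (rank_position q y \<circ> \<sigma>)) es e \<longleftrightarrow>
      find (\<lambda>x. f x \<in> C) es = Some e" if "f e = 0" for e
    using that by (simp add: class_leader_def)
  have "orb_decode q C es (coordinate_permute \<sigma> y) = map_option f (find (\<lambda>x. f x \<in> C) es)"
    by (simp add: orb_decode_def find_map f_eta o_def)
  then have "orb_decode q C es (coordinate_permute \<sigma> y) = Some 0 \<longleftrightarrow>
      (\<exists>e. find (\<lambda>x. f x \<in> C) es = Some e \<and> f e = 0)"
    by simp
  also have "\<dots> \<longleftrightarrow> (\<exists>e\<in>set es. f e = 0 \<and> class_leader (coset_rel (rank_position q y \<circ> \<sigma>)) es e)"
    using leader find_SomeD(1) by metis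
  finally show ?thesis by (simp add: f_0)
qed

section \<open>Averaging over all permutations\<close>

lemma measure_noise_law_eq_integral:
  assumes "Measurable.pred borel P"
  shows "measure (noise_law q) {y :: (real, 'n) vec. P y} = (\<integral>y. of_bool (P y) \<partial>noise_law q)"
proof -
  have "(\<integral>y. of_bool (P y) \<partial>noise_law q) = (\<integral>y. indicator {y. P y} y \<partial>noise_law q :: real)"
    by (intro Bochner_Integration.integral_cong) (auto simp: indicator_def)
  then show ?thesis by simp
qed

text \<open>
  Precomposing with the rank permutation permutes the summands over all \<open>\<tau>\<close>, so averaging makes the
  coset condition independent of the output.
\<close>

lemma card_bij_times_success_prob:
  "real (card {\<tau> :: 'n \<Rightarrow> 'n. bij \<tau>}) * success_prob q C es =
    (\<Sum>\<tau> | bij \<tau>. \<Sum>e\<in>{e\<in>set es. class_leader (coset_rel \<tau>) es e}. pattern_prob e)"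
proof -
  let ?B = "{\<tau> :: 'n \<Rightarrow> 'n. bij \<tau>}"
  let ?P = "\<lambda>\<sigma> y. orb_decode q C es (coordinate_permute \<sigma> y) = Some 0"
  let ?L = "\<lambda>\<tau> e. class_leader (coset_rel \<tau>) es e"
  \<comment> \<open>By exchangeability, permuting the output beforehand leaves the success
    probability unchanged.\<close>
  have success: "success_prob q C es = (\<integral>y. of_bool (?P \<sigma> y) \<partial>noise_law q)" if "bij \<sigma>" for \<sigma>
  proof -
    let ?A = "{y. orb_decode q C es y = Some 0}"
    have [measurable]: "?A \<in> sets borel" by measurable
    have "emeasure (noise_law q) ?A = (\<integral>\<^sup>+y. indicator ?A y \<partial>noise_law q)"
      by simp
    also have "\<dots> = (\<integral>\<^sup>+y. indicator ?A (coordinate_permute \<sigma> y) \<partial>noise_law q)"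
      by (rule nn_integral_noise_law_permute[symmetric, OF prob_density that]) simp
    also have "\<dots> = (\<integral>\<^sup>+y. indicator {y. ?P \<sigma> y} y \<partial>noise_law q)"
      by (intro nn_integral_cong) (auto simp: indicator_def)
    also have "\<dots> = emeasure (noise_law q) {y. ?P \<sigma> y}"
      by (intro nn_integral_indicator) measurable
    finally have "success_prob q C es = measure (noise_law q) {y. ?P \<sigma> y}"
      by (simp add: success_prob_eq measure_def)
    also have "\<dots> = (\<integral>y. of_bool (?P \<sigma> y) \<partial>noise_law q)"
      by (rule measure_noise_law_eq_integral) measurable
    finally show ?thesis .
  qed
  have int: "integrable (noise_law q) (\<lambda>y. of_bool (Q y) :: real)" if [measurable]: "Measurable.pred borel Q"
    for Q :: "(real, 'n) vec \<Rightarrow> bool"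
    by (rule noise.integrable_const_bound[where B=1]) auto
  have reindex: "(\<Sum>\<sigma>\<in>?B. h (rank_position q y \<circ> \<sigma>)) = sum h ?B" for y and h :: "('n \<Rightarrow> 'n) \<Rightarrow> real"
  proof (rule sum.reindex_bij_betw, rule bij_betw_byWitness[where f'="\<lambda>\<tau>. inv (rank_position q y) \<circ> \<tau>"])
    note b = bij_rank_position[of q y]
    show "\<forall>\<sigma>\<in>?B. inv (rank_position q y) \<circ> (rank_position q y \<circ> \<sigma>) = \<sigma>"
      using b by (simp add: comp_assoc[symmetric] bij_is_inj)
    show "\<forall>\<tau>\<in>?B. rank_position q y \<circ> (inv (rank_position q y) \<circ> \<tau>) = \<tau>"
      using b by (auto simp: fun_eq_iff bij_is_surj surj_f_inv_f)
    show "(\<lambda>\<sigma>. rank_position q y \<circ> \<sigma>) ` ?B \<subseteq> ?B" "(\<lambda>\<tau>. inv (rank_position q y) \<circ> \<tau>) ` ?B \<subseteq> ?B"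
      using b by (auto intro: bij_comp bij_imp_bij_inv)
  qed
  \<comment> \<open>By \<open>candidate_inj\<close> at most one pattern has candidate zero, so for
    each \<sigma> the sum over patterns is a single indicator. Then \<open>reindex\<close> absorbs
    the ranks, and only the factor \<open>candidate q y e = 0\<close> still involves
    \<open>y\<close>.\<close>
  have ptw: "(\<Sum>\<sigma>\<in>?B. of_bool (?P \<sigma> y)) =
      (\<Sum>\<tau>\<in>?B. \<Sum>e\<in>set es. of_bool (?L \<tau> e) * of_bool (candidate q y e = 0) :: real)"
    if inj: "inj (reliability q y)" for y
  proof -
    have "of_bool (?P \<sigma> y) = (\<Sum>e\<in>set es. of_bool (?L (rank_position q y \<circ> \<sigma>) e) *
        of_bool (candidate q y e = 0) :: real)" if "bij \<sigma>" for \<sigma>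
    proof (cases "\<exists>e\<in>set es. candidate q y e = 0")
      case True
      then obtain e where e: "e \<in> set es" "candidate q y e = 0" by auto
      then have eq: "candidate q y x = 0 \<longleftrightarrow> x = e" for x
        using candidate_inj by metis
      have "(\<Sum>x\<in>set es. of_bool (?L (rank_position q y \<circ> \<sigma>) x) * of_bool (candidate q y x = 0) :: real) =
          (\<Sum>x\<in>set es. if x = e then of_bool (?L (rank_position q y \<circ> \<sigma>) e) else 0)"
        by (intro sum.cong) (auto simp: eq)
      also have "\<dots> = of_bool (?P \<sigma> y)"
        using e by (simp add: orb_decode_permute[OF that inj] eq)
      finally show ?thesis ..
    next
      case False
      then show ?thesis by (auto simp: orb_decode_permute[OF that inj])
    qed
    then have "(\<Sum>\<sigma>\<in>?B. of_bool (?P \<sigma> y) :: real) = (\<Sum>\<sigma>\<in>?B. \<Sum>e\<in>set es.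
        of_bool (?L (rank_position q y \<circ> \<sigma>) e) * of_bool (candidate q y e = 0))"
      by (intro sum.cong) auto
    also note reindex
    finally show ?thesis .
  qed
  have linear: "(\<integral>y. (\<Sum>\<tau>\<in>?B. \<Sum>e\<in>set es. c \<tau> e * of_bool (candidate q y e = 0)) \<partial>noise_law q) =
      (\<Sum>\<tau>\<in>?B. \<Sum>e\<in>set es. c \<tau> e * pattern_prob e)" for c :: "('n \<Rightarrow> 'n) \<Rightarrow> (bit, 'n) vec \<Rightarrow> real"
    \<comment> \<open>The sum over \<open>e\<close> must keep an index set free of \<open>y\<close>
      so that the integral can pass inside; absorbing the indicator into the index set would prevent
      this.\<close>
    by (simp add: Bochner_Integration.integral_sum int pattern_prob_def measure_noise_law_eq_integral
        del: sum_mult_of_bool_eq)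
  have "real (card ?B) * success_prob q C es = (\<Sum>\<sigma>\<in>?B. \<integral>y. of_bool (?P \<sigma> y) \<partial>noise_law q)"
  proof -
    have "(\<Sum>\<sigma>\<in>?B. \<integral>y. of_bool (?P \<sigma> y) \<partial>noise_law q) = (\<Sum>\<sigma>\<in>?B. success_prob q C es)"
      by (intro sum.cong) (auto simp: success)
    then show ?thesis by simp
  qed
  also have "\<dots> = (\<integral>y. (\<Sum>\<sigma>\<in>?B. of_bool (?P \<sigma> y)) \<partial>noise_law q)"
    by (intro Bochner_Integration.integral_sum[symmetric] int) measurable
  also have "\<dots> = (\<integral>y. (\<Sum>\<tau>\<in>?B. \<Sum>e\<in>set es. of_bool (?L \<tau> e) * of_bool (candidate q y e = 0)) \<partial>noise_law q)"
  proof (rule integral_cong_AE)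
    show "AE y in noise_law q. (\<Sum>\<sigma>\<in>?B. of_bool (?P \<sigma> y)) =
        (\<Sum>\<tau>\<in>?B. \<Sum>e\<in>set es. of_bool (?L \<tau> e) * of_bool (candidate q y e = 0) :: real)"
      using AE_reliability_inj by eventually_elim (rule ptw)
  qed measurable
  also have "\<dots> = (\<Sum>\<tau>\<in>?B. \<Sum>e\<in>set es. of_bool (?L \<tau> e) * pattern_prob e)"
    by (rule linear)
  also have "\<dots> = (\<Sum>\<tau>\<in>?B. \<Sum>e\<in>{e\<in>set es. ?L \<tau> e}. pattern_prob e)"
    by (simp add: Int_def)
  finally show ?thesis .
qed

text \<open>For each fixed \<tau> the relation is an equivalence and the sorted list has the largest
  sum over coset leaders. The comparison is therefore termwise in \<tau>, and the common positive
  factor cancels.\<close>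

lemma success_prob_le_sorted:
  assumes "sorted_wrt (\<lambda>x y. pattern_prob x \<ge> pattern_prob y) es" "set es' = set es"
  shows "success_prob q C es' \<le> success_prob q C es"
proof -
  let ?c = "real (card {\<tau> :: 'n \<Rightarrow> 'n. bij \<tau>})"
  have "?c * success_prob q C es' \<le> ?c * success_prob q C es"
    unfolding card_bij_times_success_prob
    by (intro sum_mono sum_class_leaders_le_sorted equivp_coset_rel assms) (simp add: pattern_prob_def)
  moreover have "{\<tau> :: 'n \<Rightarrow> 'n. bij \<tau>} \<noteq> {}"
    using bij_id by blast
  then have "0 < ?c" by (simp add: card_gt_0_iff)
  ultimately show ?thesis by simp
qed

end

theorem theorem5:
  fixes q :: "bit \<Rightarrow> real \<Rightarrow> real"
    and C :: "(bit ^ 'n::{finite, linorder}) set"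
    and S :: "(bit ^ 'n::{finite, linorder}) set"
    and K T :: nat
  assumes "\<And>b. prob_density (q b)"
    and "output_symmetric q"
    and "linear_block_code K C"
    and "\<And>i. map_pmf (\<lambda>w. w $ i) (pmf_of_set C) = pmf_of_set UNIV"
    and "atomless_reliabilities q C"
    and "card S = T"
  shows "\<exists>es \<in> permutations_of_set S.
           (\<forall>es' \<in> permutations_of_set S. success_prob q C es' \<le> success_prob q C es) \<and>
           (\<forall>t. Suc t < T \<longrightarrow> p_seq q C es t \<ge> p_seq q C es (Suc t))"
proof -
  interpret symmetric_channel_code q C
    using assms by unfold_locales (auto simp: linear_block_code_def)
  obtain xs where xs: "set xs = S" "distinct xs"
    using finite_distinct_list[of S] by auto
  \<comment> \<open>Sorting is ascending, so the key is negated. By \<open>p_seq_eq\<close> the same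
    order makes the sequence non-increasing.\<close>
  define es where "es = sort_key (\<lambda>e. - pattern_prob e) xs"
  have es: "es \<in> permutations_of_set S"
    using xs by (auto simp: es_def permutations_of_set_def)
  have sorted: "sorted_wrt (\<lambda>x y. pattern_prob x \<ge> pattern_prob y) es"
    using sorted_sort_key[of "\<lambda>e. - pattern_prob e" xs]
    by (simp add: es_def sorted_map)
  have "length es = T"
    using es assms(6) by (auto simp: length_finite_permutations_of_set)
  then have "p_seq q C es (Suc t) \<le> p_seq q C es t" if "Suc t < T" for t
    using sorted_wrt_nth_less[OF sorted, of t "Suc t"] that by (simp add: p_seq_eq)
  moreover have "success_prob q C es' \<le> success_prob q C es" if "es' \<in> permutations_of_set S" for es'
    using that es by (intro success_prob_le_sorted[OF sorted]) (auto simp: permutations_of_set_def)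
  ultimately show ?thesis
    using es by blast
qed

end
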